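(* We have $$\bigcap_{M} \mathcal{L}(M) = \big\{\{0\}, \{1\}\big\},$$ where the intersection is taken over all nontrivial atomic Puiseux monoids $M$.
   Context: A Puiseux monoid is an additive submonoid of $\mathbb{Q}_{\ge 0}$ (containing $0$); it is nontrivial if it is not $\{0\}$. An atom of a Puiseux monoid $M$ is a nonzero element $a \in M$ such that $a = u+v$ with $u,v \in M$ implies $u = 0$ or $v = 0$; $\mathcal{A}(M)$ is the set of atoms, and $M$ is atomic if $\mathcal{A}(M)$ generates $M$. A factorization of $x \in M$ is a formal (unordered) sum $a_1 + \dots + a_n$ of atoms, i.e. an element of the free commutative monoid on $\mathcal{A}(M)$, whose value in $M$ is $x$; its length is $n$ (the empty sum, of length $0$, is the only factorization of $0$). The set of lengths $\mathsf{L}(x)$ is the set of all lengths of factorizations of $x$, and $\mathcal{L}(M) = \{\mathsf{L}(x) \mid x \in M\}$ is the system of sets of lengths of $M$. *)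

theory Defs
  imports Complex_Main "HOL-Library.Multiset"
begin

definition add_submonoid :: "rat set \<Rightarrow> bool" where
  "add_submonoid M \<longleftrightarrow> 0 \<in> M \<and> (\<forall>x\<in>M. \<forall>y\<in>M. x + y \<in> M)"

definition puiseux_monoid :: "rat set \<Rightarrow> bool" where
  "puiseux_monoid M \<longleftrightarrow> add_submonoid M \<and> M \<subseteq> {0..}"

definition atoms :: "rat set \<Rightarrow> rat set" where
  "atoms M = {a \<in> M. a \<noteq> 0 \<and> (\<forall>u\<in>M. \<forall>v\<in>M. a = u + v \<longrightarrow> u = 0 \<or> v = 0)}"

(* The hull is the intersection of all additive submonoids of the rationals
   containing the atoms, i.e. the submonoid that they generate. *)
definition atomic :: "rat set \<Rightarrow> bool" where
  "atomic M \<longleftrightarrow> add_submonoid hull (atoms M) = M"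

(* The free commutative monoid on the atoms is realised as the finite multisets
   with support in the set of atoms. *)
definition factorizations :: "rat set \<Rightarrow> rat \<Rightarrow> rat multiset set" where
  "factorizations M x = {F. set_mset F \<subseteq> atoms M \<and> sum_mset F = x}"

definition lengths :: "rat set \<Rightarrow> rat \<Rightarrow> nat set" where
  "lengths M x = size ` factorizations M x"

definition system_of_lengths :: "rat set \<Rightarrow> nat set set" where
  "system_of_lengths M = lengths M ` M"

end

theory Submission
  imports Defs "HOL-Library.Nat_Bijection"
begin

text \<open>
  The additive monoid of the natural numbers shows that a common set of lengths is a singleton
  \<open>{n}\<close>. If \<open>n \<ge> 2\<close>, then the sum of two of the \<open>n\<close> atoms involved has \<open>{2}\<close> as its set of
  lengths, so it suffices to find an atomic Puiseux monoid in which the sum of any two atoms has a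
  factorization of length at least 3. Start with the generator 1 and, running through all pairs
  \<open>(a, b)\<close> of generators, adjoin a new generator \<open>(a + b) / q\<close>. If \<open>q\<close> is coprime to the
  numerator of \<open>a + b\<close> over a common denominator of the old generators, then a sum of generators
  that lies in the old monoid uses the new generator a multiple of \<open>q\<close> times; each \<open>q\<close> copies can
  be traded for \<open>a + b\<close>, and therefore no old atom decomposes.
\<close>

section \<open>Monoids generated by positive rationals, and their atoms\<close>

definition generated :: "rat set \<Rightarrow> rat set" where
  "generated G = {sum_mset F |F. set_mset F \<subseteq> G}"

text \<open>For a set \<open>G\<close> of positive numbers this makes the generators exactly the
  atoms of \<open>generated G\<close>. A violation involves only finitely many generators, so the
  property survives unions of increasing chains.\<close>

definition irredundant :: "rat set \<Rightarrow> bool" where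
  "irredundant G \<longleftrightarrow> (\<forall>F. set_mset F \<subseteq> G \<longrightarrow> sum_mset F \<in> G \<longrightarrow> size F = 1)"

lemma sum_mset_pos_rat:
  fixes F :: "rat multiset"
  assumes "set_mset F \<subseteq> {0<..}" "F \<noteq> {#}"
  shows "0 < sum_mset F"
  using assms
proof (induction F)
  case (add x F)
  then show ?case by (cases "F = {#}") (auto intro: add_pos_pos)
qed simp

lemma sum_mset_nonneg_rat:
  fixes F :: "rat multiset"
  assumes "set_mset F \<subseteq> {0<..}"
  shows "0 \<le> sum_mset F"
  using assms sum_mset_pos_rat[of F] by (cases "F = {#}") auto

lemma sum_mset_in_submonoid:
  assumes "add_submonoid M" "set_mset F \<subseteq> M"
  shows "sum_mset F \<in> M"
  using assms(2) by (induction F) (use assms(1) in \<open>auto simp: add_submonoid_def\<close>)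

lemma add_submonoid_generated: "add_submonoid (generated G)"
  unfolding add_submonoid_def generated_def
proof (safe, goal_cases)
  case 1
  then show ?case by (intro exI[of _ "{#}"]) auto
next
  case (2 _ _ F F')
  then show ?case by (intro exI[of _ "F + F'"]) auto
qed

lemma generated_superset: "G \<subseteq> generated G"
proof
  fix x assume "x \<in> G"
  then show "x \<in> generated G"
    unfolding generated_def by (intro CollectI exI[of _ "{#x#}"]) auto
qed

lemma hull_eq_generated: "add_submonoid hull G = generated G"
proof (rule hull_unique)
  show "generated G \<subseteq> M" if "G \<subseteq> M" "add_submonoid M" for M
    using that sum_mset_in_submonoid[of M] unfolding generated_def by blast
qed (use generated_superset add_submonoid_generated in auto)

lemma puiseux_generated:
  assumes "G \<subseteq> {0<..}"
  shows "puiseux_monoid (generated G)"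
  using assms sum_mset_nonneg_rat add_submonoid_generated
  unfolding puiseux_monoid_def generated_def by fastforce

lemma atoms_generated:
  assumes pos: "G \<subseteq> {0<..}" and irr: "irredundant G"
  shows "atoms (generated G) = G"
proof (intro subset_antisym subsetI)
  fix x assume x: "x \<in> atoms (generated G)"
  then obtain F where F: "x = sum_mset F" "set_mset F \<subseteq> G" "x \<noteq> 0"
    unfolding atoms_def generated_def by auto
  \<comment> \<open>Splitting off one generator \<open>a\<close> from the sum forces the rest to
    vanish, because \<open>x\<close> is an atom; hence \<open>x = a\<close>.\<close>
  then obtain a F' where F': "F = add_mset a F'" by (cases F) auto
  have "a \<in> generated G" "sum_mset F' \<in> generated G" "x = a + sum_mset F'"
    using F F' generated_superset by (auto simp: generated_def)
  moreover have "a \<in> G" "a \<noteq> 0" using F F' pos by auto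
  ultimately show "x \<in> G" using x unfolding atoms_def by auto
next
  fix x assume x: "x \<in> G"
  have "u = 0 \<or> v = 0" if uv: "u \<in> generated G" "v \<in> generated G" "x = u + v" for u v
  proof -
    obtain F F' where F: "u = sum_mset F" "set_mset F \<subseteq> G" "v = sum_mset F'" "set_mset F' \<subseteq> G"
      using uv unfolding generated_def by auto
    \<comment> \<open>Total size 1 leaves one of the two multisets empty, so its sum is 0.\<close>
    have "size (F + F') = 1"
      using irr[unfolded irredundant_def, rule_format, of "F + F'"] F uv x by auto
    then show ?thesis using F by (cases F; cases F') auto
  qed
  then show "x \<in> atoms (generated G)"
    using x pos generated_superset[of G] unfolding atoms_def by auto
qed

lemma atomic_generated:
  assumes "G \<subseteq> {0<..}" "irredundant G"
  shows "atomic (generated G)"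
  by (simp add: atomic_def atoms_generated[OF assms] hull_eq_generated)

lemma nontrivial_generated:
  assumes "G \<subseteq> {0<..}" "G \<noteq> {}"
  shows "generated G \<noteq> {0}"
  using assms generated_superset[of G] by (metis greaterThan_iff less_irrefl singletonD subset_eq ex_in_conv)

section \<open>Lengths of zero and of atoms in an arbitrary Puiseux monoid\<close>

lemma atoms_pos:
  assumes "puiseux_monoid M"
  shows "atoms M \<subseteq> {0<..}"
  using assms unfolding atoms_def puiseux_monoid_def by force

text \<open>Once one summand is split off, the atom property makes the remaining sum zero, and a sum
  of positive numbers vanishes only if it is empty.\<close>

lemma irredundant_atoms:
  assumes "puiseux_monoid M"
  shows "irredundant (atoms M)"
  unfolding irredundant_def
proof (intro allI impI)
  fix F assume F: "set_mset F \<subseteq> atoms M" "sum_mset F \<in> atoms M"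
  note pos = atoms_pos[OF assms]
  from F pos obtain a F' where F': "F = add_mset a F'" by (cases F) auto
  have "set_mset F' \<subseteq> M" using F F' unfolding atoms_def by auto
  then have "sum_mset F' \<in> M"
    using assms sum_mset_in_submonoid unfolding puiseux_monoid_def by blast
  moreover have "a \<in> M" "a \<noteq> 0" "sum_mset F = a + sum_mset F'"
    using F F' unfolding atoms_def by auto
  ultimately have "sum_mset F' = 0" using F(2) unfolding atoms_def by blast
  then have "F' = {#}" using sum_mset_pos_rat[of F'] F F' pos by fastforce
  then show "size F = 1" using F' by simp
qed

lemma lengths_zero:
  assumes "puiseux_monoid M"
  shows "lengths M 0 = {0}"
proof -
  have "F = {#}" if "F \<in> factorizations M 0" for F
    using that sum_mset_pos_rat[of F] atoms_pos[OF assms] unfolding factorizations_def by auto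
  then have "factorizations M 0 = {{#}}"
    unfolding factorizations_def by auto
  then show ?thesis unfolding lengths_def by simp
qed

lemma lengths_atom:
  assumes "puiseux_monoid M" "a \<in> atoms M"
  shows "lengths M a = {1}"
proof -
  have "{#a#} \<in> factorizations M a" using assms unfolding factorizations_def by simp
  moreover have "size F = 1" if "F \<in> factorizations M a" for F
    using that irredundant_atoms[OF assms(1)] assms(2)
    unfolding factorizations_def irredundant_def by auto
  ultimately show ?thesis unfolding lengths_def by force
qed

lemma zero_in_system:
  assumes "puiseux_monoid M"
  shows "{0} \<in> system_of_lengths M"
  using lengths_zero[OF assms] assms
  unfolding system_of_lengths_def puiseux_monoid_def add_submonoid_def by (metis imageI)

lemma one_in_system:
  assumes "puiseux_monoid M" "M \<noteq> {0}" "atomic M"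
  shows "{1} \<in> system_of_lengths M"
proof -
  \<comment> \<open>Without atoms, only the empty sum would be generated, and \<open>M\<close> would
    be \<open>{0}\<close>.\<close>
  have "atoms M \<noteq> {}"
    using assms(2,3) by (auto simp: atomic_def hull_eq_generated generated_def)
  then obtain a where a: "a \<in> atoms M" by blast
  then have "a \<in> M" unfolding atoms_def by simp
  then show ?thesis using lengths_atom[OF assms(1) a] unfolding system_of_lengths_def by (metis imageI)
qed

section \<open>The monoid of natural numbers\<close>

lemma sum_mset_ones:
  fixes F :: "rat multiset"
  assumes "set_mset F \<subseteq> {1}"
  shows "sum_mset F = of_nat (size F)"
  using assms by (induction F) auto

lemma irredundant_one: "irredundant {1}"
  using sum_mset_ones unfolding irredundant_def by fastforce

text \<open>With 1 as the only atom, the length of a factorization equals its value.\<close>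

lemma system_of_lengths_one:
  assumes "S \<in> system_of_lengths (generated {1})"
  shows "\<exists>n. S = {n}"
proof -
  obtain x where x: "x \<in> generated {1}" "S = lengths (generated {1}) x"
    using assms unfolding system_of_lengths_def by auto
  have fact: "F \<in> factorizations (generated {1}) x \<longleftrightarrow> set_mset F \<subseteq> {1} \<and> sum_mset F = x" for F
    using atoms_generated[OF _ irredundant_one] unfolding factorizations_def by simp
  have "rat_of_nat (size F) = x" if "F \<in> factorizations (generated {1}) x" for F
    using that sum_mset_ones[of F] unfolding fact by simp
  then have size: "size F = size F'" if "F \<in> factorizations (generated {1}) x"
      "F' \<in> factorizations (generated {1}) x" for F F'
    using that by (metis of_nat_eq_iff)
  obtain F where F: "F \<in> factorizations (generated {1}) x"
    using x(1) unfolding fact unfolding generated_def by blast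
  have "S = {size F}"
    unfolding x(2) lengths_def using size[OF _ F] F by blast
  then show ?thesis by blast
qed

section \<open>Adjoining one generator\<close>

lemma irredundant_insert:
  fixes G :: "rat set" and D p :: nat and t :: int
  assumes pos: "G \<subseteq> {0<..}" and irr: "irredundant G"
    and int: "\<And>x. x \<in> G \<Longrightarrow> of_nat D * x \<in> \<int>"
    and a: "a \<in> G" and b: "b \<in> G"
    and t: "of_nat D * (a + b) = of_int t" and cop: "coprime (int p) t" and p: "p > 1"
  shows "irredundant (insert ((a + b) / of_nat p) G)"
  unfolding irredundant_def
proof (intro allI impI)
  let ?h = "(a + b) / of_nat p"
  fix F assume F: "set_mset F \<subseteq> insert ?h G" "sum_mset F \<in> insert ?h G"
  define c where "c = count F ?h"
  define F' where "F' = filter_mset (\<lambda>x. x \<noteq> ?h) F"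
  have F'G: "set_mset F' \<subseteq> G" using F(1) unfolding F'_def by auto
  have split: "F = F' + replicate_mset c ?h"
    unfolding F'_def c_def by (rule multiset_eqI) auto
  then have sumF: "sum_mset F = sum_mset F' + of_nat c * ?h" by simp
  have intF': "of_nat D * sum_mset F' \<in> \<int>"
    using F'G by (induction F') (auto simp: distrib_left intro: int Ints_add)
  \<comment> \<open>Multiplied by \<open>D\<close>, the new generator becomes \<open>t / p\<close>,
    a fraction in lowest terms, so only multiples of \<open>p\<close> clear its denominator.\<close>
  have div: "int p dvd m" if "of_nat D * (of_int m * ?h) \<in> \<int>" for m
  proof -
    from that obtain k where "of_nat D * (of_int m * ?h) = of_int k" by (rule Ints_cases)
    then have "of_int m * (of_nat D * (a + b)) = of_int k * (of_nat p :: rat)"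
      using p by (simp add: field_simps)
    then have "of_int (m * t) = (of_int (k * int p) :: rat)" unfolding t by simp
    then have "int p dvd m * t" by (metis dvd_triv_right of_int_eq_iff)
    then show ?thesis using cop coprime_dvd_mult_left_iff by blast
  qed
  show "size F = 1"
  proof (cases "sum_mset F \<in> G")
    case True
    have "of_nat D * (of_int (int c) * ?h) = of_nat D * sum_mset F - of_nat D * sum_mset F'"
      unfolding sumF by (simp add: distrib_left)
    then have "int p dvd int c" using int[OF True] intF' by (intro div) auto
    then obtain d where d: "c = p * d" by auto
    \<comment> \<open>Each \<open>p\<close> copies of \<open>?h\<close> are traded for one
      \<open>a\<close> and one \<open>b\<close>, which keeps the sum and leaves only elements of
      \<open>G\<close>. The new size is \<open>size F' + 2 * d\<close>, so irredundancy of
      \<open>G\<close> forces \<open>d = 0\<close>.\<close>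
    define F'' where "F'' = F' + replicate_mset d a + replicate_mset d b"
    have "sum_mset F'' = sum_mset F"
      unfolding F''_def sumF d using p by (simp add: field_simps)
    moreover have "set_mset F'' \<subseteq> G" using F'G a b unfolding F''_def by auto
    ultimately have "size F'' = 1" using irr True unfolding irredundant_def by auto
    then have "size F' + 2 * d = 1" unfolding F''_def by simp
    then have "d = 0" "size F' = 1" by presburger+
    then show ?thesis using split d by simp
  next
    case False
    then have h: "sum_mset F = ?h" using F(2) by blast
    have "?h > 0" using pos a b p by (auto intro!: divide_pos_pos add_pos_pos)
    \<comment> \<open>If \<open>?h\<close> did not occur, \<open>of_nat D * ?h\<close> would be an
      integer and \<open>p\<close> would divide 1. One occurrence already exhausts the sum, so by
      positivity nothing else is left.\<close>
    have "c \<noteq> 0"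
    proof
      assume "c = 0"
      then have "of_nat D * (of_int 1 * ?h) \<in> \<int>" using intF' h sumF by simp
      then show False using div[of 1] p by simp
    qed
    then have "?h \<le> of_nat c * ?h"
      using \<open>?h > 0\<close> mult_right_mono[of 1 "of_nat c" ?h] by simp
    moreover have "sum_mset F' \<ge> 0" using sum_mset_nonneg_rat F'G pos by blast
    ultimately have sum0: "sum_mset F' = 0" and "of_nat c * ?h = ?h"
      using h sumF by linarith+
    then have "c = 1" using \<open>?h > 0\<close> p by (auto simp del: zero_less_divide_iff)
    moreover have "F' = {#}" using sum0 sum_mset_pos_rat[of F'] F'G pos by force
    ultimately show ?thesis using split by simp
  qed
qed

section \<open>The sequence of generators\<close>

fun common_denom :: "nat \<Rightarrow> nat" where
  "common_denom 0 = 1"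
| "common_denom (Suc n) = common_denom n * (fact (2 * common_denom n) + 1)"

text \<open>All generators will be at most 1, so the numerator of a sum of two of them over
  \<open>common_denom n\<close> is at most \<open>2 * common_denom n\<close>. It divides the
  factorial and is therefore coprime to its successor. The same number is the new factor in
  \<open>common_denom (Suc n)\<close>.\<close>

definition quot :: "nat \<Rightarrow> nat" where
  "quot n = fact (2 * common_denom n) + 1"

lemma prod_decode_bounds:
  "fst (prod_decode n) \<le> n" "snd (prod_decode n) \<le> n"
  by (metis le_prod_encode_1 prod.collapse prod_decode_inverse)
     (metis le_prod_encode_2 prod.collapse prod_decode_inverse)

text \<open>Stage \<open>n\<close> treats the pair of indices coded by \<open>n\<close>. Both
  indices are at most \<open>n\<close>, so their generators exist already, and every pair gets its
  turn.\<close>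

function gen :: "nat \<Rightarrow> rat" where
  "gen 0 = 1"
| "gen (Suc n) = (gen (fst (prod_decode n)) + gen (snd (prod_decode n))) / of_nat (quot n)"
  by pat_completeness auto
termination
  by (relation "measure id") (auto simp: prod_decode_bounds le_imp_less_Suc)

lemma common_denom_pos: "common_denom n > 0"
  by (induction n) auto

lemma quot_ge: "quot n \<ge> 3"
proof -
  have "fact 2 \<le> (fact (2 * common_denom n) :: nat)"
    using common_denom_pos[of n] by (intro fact_mono_nat) simp
  then show ?thesis by (simp add: quot_def)
qed

text \<open>A sum of two earlier generators is at most 2 and gets divided by at least 3.\<close>

lemma gen_bounds: "0 < gen n \<and> gen n \<le> 1"
proof (induction n rule: less_induct)
  case (less n)
  show ?case
  proof (cases n)
    case (Suc m)
    let ?i = "fst (prod_decode m)" and ?j = "snd (prod_decode m)"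
    have "0 < gen ?i" "gen ?i \<le> 1" "0 < gen ?j" "gen ?j \<le> 1"
      using less prod_decode_bounds[of m] Suc by (auto simp: le_imp_less_Suc)
    moreover have "(3::rat) \<le> of_nat (quot m)"
      using quot_ge[of m] by (metis of_nat_le_iff of_nat_numeral)
    ultimately show ?thesis using Suc by (simp add: field_simps)
  qed simp
qed

text \<open>The factor \<open>quot n\<close> cancels the division in \<open>gen (Suc n)\<close>,
  which leaves two earlier generators times \<open>common_denom n\<close>.\<close>

lemma common_denom_gen: "k \<le> n \<Longrightarrow> of_nat (common_denom n) * gen k \<in> \<int>"
proof (induction n arbitrary: k)
  case (Suc n)
  let ?q = "of_nat (quot n) :: rat"
  have D: "of_nat (common_denom (Suc n)) = of_nat (common_denom n) * ?q"
    by (simp only: common_denom.simps quot_def of_nat_mult)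
  show ?case
  proof (cases "k = Suc n")
    case True
    have "of_nat (common_denom (Suc n)) * gen k = of_nat (common_denom n) * gen (fst (prod_decode n))
        + of_nat (common_denom n) * gen (snd (prod_decode n))"
      unfolding D True using quot_ge[of n] by (simp add: field_simps)
    then show ?thesis using Suc.IH prod_decode_bounds by auto
  next
    case False
    then have "of_nat (common_denom n) * gen k \<in> \<int>" using Suc by simp
    moreover have "of_nat (common_denom (Suc n)) * gen k = of_nat (common_denom n) * gen k * ?q"
      unfolding D by simp
    ultimately show ?thesis by (metis Ints_mult Ints_of_nat)
  qed
qed simp

lemma coprime_fact_plus_one:
  assumes "0 < t" "t \<le> n"
  shows "coprime (fact n + 1) (t :: nat)"
proof (rule coprimeI)
  fix d assume d: "d dvd fact n + 1" "d dvd t"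
  have "t dvd fact n" using assms by (simp add: dvd_fact)
  then have "d dvd fact n" using d(2) dvd_trans by blast
  then show "is_unit d" using d(1) dvd_add_right_iff by blast
qed

lemma irredundant_gen_prefix: "irredundant (gen ` {..n})"
proof (induction n)
  case 0
  then show ?case using irredundant_one by simp
next
  case (Suc n)
  let ?a = "gen (fst (prod_decode n))" and ?b = "gen (snd (prod_decode n))"
  let ?D = "common_denom n"
  have "of_nat ?D * (?a + ?b) \<in> \<int>"
    unfolding distrib_left by (intro Ints_add common_denom_gen prod_decode_bounds)
  then obtain t where t: "of_nat ?D * (?a + ?b) = of_int t" by (rule Ints_cases)
  have "0 < ?a + ?b" "?a + ?b \<le> 2"
    using gen_bounds[of "fst (prod_decode n)"] gen_bounds[of "snd (prod_decode n)"] by auto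
  then have "0 < of_nat ?D * (?a + ?b)" "of_nat ?D * (?a + ?b) \<le> of_nat ?D * 2"
    using common_denom_pos[of n] by auto
  then have "0 < t" "rat_of_int t \<le> of_int (2 * int ?D)" unfolding t by auto
  then have "0 < nat t" "nat t \<le> 2 * ?D" unfolding of_int_le_iff by auto
  then have "coprime (int (quot n)) (int (nat t))"
    unfolding quot_def coprime_int_iff by (rule coprime_fact_plus_one)
  then have "coprime (int (quot n)) t" using \<open>0 < t\<close> by simp
  moreover have "gen ` {..n} \<subseteq> {0<..}" using gen_bounds by auto
  ultimately have "irredundant (insert ((?a + ?b) / of_nat (quot n)) (gen ` {..n}))"
    using Suc t quot_ge[of n] prod_decode_bounds[of n] common_denom_gen[of _ n]
    by (intro irredundant_insert[where D = ?D and t = t]) auto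
  then show ?case by (simp add: atMost_Suc)
qed

lemma irredundant_gen: "irredundant (range gen)"
  unfolding irredundant_def
proof (intro allI impI)
  fix F assume F: "set_mset F \<subseteq> range gen" "sum_mset F \<in> range gen"
  then have "finite (insert (sum_mset F) (set_mset F))" "insert (sum_mset F) (set_mset F) \<subseteq> range gen"
    by auto
  \<comment> \<open>The summands and their sum are finitely many generators, so they all occur in a
    finite prefix of the sequence.\<close>
  then obtain K where K: "finite K" "insert (sum_mset F) (set_mset F) = gen ` K"
    by (metis finite_subset_image)
  then have "gen ` K \<subseteq> gen ` {..Max K}" by (intro image_mono) auto
  then have "set_mset F \<subseteq> gen ` {..Max K}" "sum_mset F \<in> gen ` {..Max K}"
    using K(2) by blast+
  then show "size F = 1"
    using irredundant_gen_prefix[of "Max K"] unfolding irredundant_def by blast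
qed

section \<open>Sets of lengths in the constructed monoid, and the intersection\<close>

lemma system_of_lengths_gen:
  assumes "{n} \<in> system_of_lengths (generated (range gen))"
  shows "n < 2"
proof (rule ccontr)
  assume "\<not> n < 2"
  have pos: "range gen \<subseteq> {0<..}" using gen_bounds by auto
  obtain x where x: "lengths (generated (range gen)) x = {n}"
    using assms unfolding system_of_lengths_def by auto
  have fact: "F \<in> factorizations (generated (range gen)) x
      \<longleftrightarrow> set_mset F \<subseteq> range gen \<and> sum_mset F = x" for F
    unfolding factorizations_def atoms_generated[OF pos irredundant_gen] by simp
  obtain F where F: "F \<in> factorizations (generated (range gen)) x" "size F = n"
    using x unfolding lengths_def by (metis imageE insertI1)
  obtain a F1 where F1: "F = add_mset a F1" using F(2) \<open>\<not> n < 2\<close> by (cases F) auto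
  obtain b F2 where F2: "F1 = add_mset b F2" using F(2) F1 \<open>\<not> n < 2\<close> by (cases F1) auto
  obtain i j where ij: "a = gen i" "b = gen j" using F F1 F2 unfolding fact by auto
  \<comment> \<open>This is the stage that treats the pair \<open>(i, j)\<close>, so
    \<open>quot m\<close> copies of \<open>gen (Suc m)\<close> can replace \<open>a\<close> and
    \<open>b\<close>. The length changes from \<open>n\<close> to \<open>n - 2 + quot m\<close>,
    which exceeds \<open>n\<close>.\<close>
  define m where "m = prod_encode (i, j)"
  define F' where "F' = F2 + replicate_mset (quot m) (gen (Suc m))"
  have "of_nat (quot m) * gen (Suc m) = a + b"
    using quot_ge[of m] by (simp add: m_def ij)
  then have "sum_mset F' = sum_mset F" unfolding F'_def F1 F2 by simp
  moreover have "set_mset F' \<subseteq> range gen" using F F1 F2 unfolding fact F'_def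
    by (auto simp del: gen.simps)
  ultimately have "F' \<in> factorizations (generated (range gen)) x" using F unfolding fact by simp
  then have "size F' = n" using x unfolding lengths_def by blast
  then show False using F(2) quot_ge[of m] unfolding F'_def F1 F2 by simp
qed

theorem corollary5p7:
  shows "(\<Inter>M\<in>{M. puiseux_monoid M \<and> M \<noteq> {0} \<and> atomic M}. system_of_lengths M)
    = {{0}, {1}}"
proof (intro subset_antisym subsetI)
  fix S
  assume S: "S \<in> (\<Inter>M\<in>{M. puiseux_monoid M \<and> M \<noteq> {0} \<and> atomic M}. system_of_lengths M)"
  have mem: "S \<in> system_of_lengths (generated G)"
    if "G \<subseteq> {0<..}" "G \<noteq> {}" "irredundant G" for G
    using S puiseux_generated[of G] nontrivial_generated[of G] atomic_generated[of G] that by blast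
  have "S \<in> system_of_lengths (generated {1})" by (rule mem) (auto simp: irredundant_one)
  then obtain n where n: "S = {n}" using system_of_lengths_one by blast
  have "S \<in> system_of_lengths (generated (range gen))"
    by (rule mem) (use gen_bounds irredundant_gen in auto)
  then have "n < 2" using system_of_lengths_gen n by simp
  then show "S \<in> {{0}, {1}}" using n by auto
next
  fix S :: "nat set"
  assume "S \<in> {{0}, {1}}"
  then show "S \<in> (\<Inter>M\<in>{M. puiseux_monoid M \<and> M \<noteq> {0} \<and> atomic M}. system_of_lengths M)"
    using zero_in_system one_in_system by auto
qed

end
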